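(* $\lim_{\xi\to0}q(\xi)=-\infty$ and $\lim_{\xi\to\infty}q(\xi)=0$.
   Context: $D=\{(t,q)\in\mathbb{R}^2:2t-q>1\}$, $D_0=\{(t,q)\in\mathbb{R}^2:2t-q>1,\ 0\le t\le1\}$. Write $[\omega_1,\dots,\omega_n+x]=\cfrac{1}{\omega_1+\cfrac{1}{\ddots+\cfrac{1}{\omega_n+x}}}$. For $(t,q)\in D$, $$P(t,q)=\lim_{n\to\infty}\frac1n\log\sum_{\omega_1=1}^\infty\cdots\sum_{\omega_n=1}^\infty\exp\Big(\sup_{x\in[0,1]}\log\prod_{j=1}^n\omega_j^q\,([\omega_j,\dots,\omega_n+x])^{2t}\Big),$$ a real-analytic function on $D$. For $\xi>0$, $(t(\xi),q(\xi))\in D_0$ is the unique solution in $D_0$ of the system $P(t,q)=q\xi$, $\frac{\partial P}{\partial q}(t,q)=\xi$. *)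

theory Defs
  imports "HOL-Analysis.Analysis"
begin

definition D :: "(real \<times> real) set" where
  "D = {(t, q). 2 * t - q > 1}"

definition D0 :: "(real \<times> real) set" where
  "D0 = {(t, q) \<in> D. 0 \<le> t \<and> t \<le> 1}"

(* cf [w1, ..., wn] x = [w1, ..., wn + x].  The value cf [] x = x only serves the
   recursion; the pressure uses nonempty words. *)
fun cf :: "nat list \<Rightarrow> real \<Rightarrow> real" where
  "cf [] x = x"
| "cf (w # ws) x = 1 / (real w + cf ws x)"

(* The n-fold iterated sum over w1, ..., wn \<ge> 1 of f [w1, ..., wn], with w1 outermost. *)
fun iter_sum :: "nat \<Rightarrow> (nat list \<Rightarrow> real) \<Rightarrow> real" where
  "iter_sum 0 f = f []"
| "iter_sum (Suc n) f = (\<Sum>\<^sub>\<infinity>w\<in>{1..}. iter_sum n (\<lambda>ws. f (w # ws)))"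

(* List positions are counted from 0, so drop j ws is the word (w_(j+1), ..., w_n). *)
definition birkhoff_sup :: "real \<Rightarrow> real \<Rightarrow> nat list \<Rightarrow> real" where
  "birkhoff_sup t q ws =
     (SUP x\<in>{0..1}. ln (\<Prod>j<length ws. real (ws ! j) powr q * cf (drop j ws) x powr (2 * t)))"

(* Only meaningful for (t, q) in D; outside D, where the sums diverge, the value is arbitrary. *)
definition P :: "real \<Rightarrow> real \<Rightarrow> real" where
  "P t q = lim (\<lambda>n. 1 / real n * ln (iter_sum n (\<lambda>ws. exp (birkhoff_sup t q ws))))"

(* The derivative is the partial derivative in q; since D is open it depends on the values
   of P on D only. *)
definition solves :: "real \<Rightarrow> real \<times> real \<Rightarrow> bool" where
  "solves \<xi> = (\<lambda>(t, q). P t q = q * \<xi> \<and> ((\<lambda>s. P t s) has_real_derivative \<xi>) (at q))"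

end

theory Submission
  imports Defs "HOL-Real_Asymp.Real_Asymp"
begin

text \<open>
  For fixed \<open>t \<ge> 0\<close> the pressure is convex in \<open>q\<close>, so the two equations of the system say that the
  line \<open>s \<mapsto> \<xi> * s\<close> is tangent to \<open>P t\<close> at \<open>q\<close>; hence \<open>\<xi> * s \<le> P t s\<close> on the whole domain. Only crude
  bounds on \<open>P\<close> are needed then. The words over the digits 1 and 2 give
  \<open>ln (1 + 2 powr q) - t * ln 9 \<le> P t q = q * \<xi>\<close>. This bounds \<open>\<xi>\<close> if \<open>q \<le> - \<epsilon>\<close>, and it keeps \<open>t\<close> away
  from 0 if \<open>- M \<le> q\<close>; in the latter case the sum over words of length two gives
  \<open>- \<xi> * s \<le> P t (- s) \<le> ln (\<zeta> s) - t * ln 2\<close>, which is negative for large \<open>s\<close>, so \<open>\<xi>\<close> is not small.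
  If \<open>q \<ge> \<epsilon>\<close>, then \<open>\<xi> * \<epsilon> / 2 \<le> P t (\<epsilon> / 2) \<le> ln (\<zeta> (1 + \<epsilon> / 2))\<close> bounds \<open>\<xi>\<close>.
\<close>

subsection \<open>Subadditive sequences\<close>

lemma subadditive_LIMSEQ_bound:
  fixes a :: "nat \<Rightarrow> real"
  assumes sub: "\<And>m n. a (m + n) \<le> a m + a n"
    and lower: "\<And>n. c * real n \<le> a n"
  obtains L where "(\<lambda>n. a n / real n) \<longlonglongrightarrow> L" "\<And>k. k > 0 \<Longrightarrow> L \<le> a k / real k"
proof -
  define L where "L = (INF k\<in>{0<..}. a k / real k)"
  have bdd: "bdd_below ((\<lambda>k. a k / real k) ` {0<..})"
    using lower by (intro bdd_belowI2[of _ c]) (simp add: pos_le_divide_eq)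
  have le: "L \<le> a k / real k" if "k > 0" for k
    unfolding L_def using that by (intro cINF_lower bdd) auto
  have mult: "a (d * k) \<le> real d * a k" if "d > 0" for d k
    using that
  proof (induction d rule: nat_induct_non_zero)
    case (Suc d)
    have "a (Suc d * k) \<le> a k + a (d * k)"
      using sub[of k "d * k"] by simp
    with Suc.IH show ?case
      by (simp add: algebra_simps)
  qed simp
  have "\<exists>N. \<forall>n\<ge>N. norm (a n / real n - L) < e" if e: "e > 0" for e
  proof -
    obtain k where k: "k > 0" "a k / real k < L + e / 2"
    proof -
      have "\<exists>k\<in>{0<..}. a k / real k < L + e / 2"
        using e cINF_less_iff[OF _ bdd, of "L + e / 2"] unfolding L_def by auto
      then show ?thesis using that by auto
    qed
    define B where "B = \<bar>a k\<bar> + (\<Sum>r<k. \<bar>a r\<bar>)"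
    define N where "N = max k (nat \<lceil>2 * B / e\<rceil> + 1)"
    show ?thesis
    proof (intro exI allI impI)
      fix n assume n: "N \<le> n"
      then have "k \<le> n" and "2 * B / e < real n"
        unfolding N_def by linarith+
      then have npos: "real n > 0" and Bn: "B / real n < e / 2"
        using \<open>k > 0\<close> \<open>e > 0\<close> by (auto simp: field_simps)
      define d r where "d = n div k" and "r = n mod k"
      have nd: "n = d * k + r" "r < k" "d > 0"
        using k \<open>k \<le> n\<close> by (auto simp: d_def r_def div_greater_zero_iff)
      have "a n \<le> a (d * k) + a r"
        using sub nd(1) by metis
      also have "\<dots> \<le> real d * a k + \<bar>a r\<bar>"
        using mult[OF \<open>d > 0\<close>, of k] by linarith
      also have "real d * a k = real n * (a k / real k) - real r / real k * a k"
        using k by (simp add: nd(1) field_simps)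
      finally have "a n \<le> real n * (a k / real k) - real r / real k * a k + \<bar>a r\<bar>" .
      moreover have "\<bar>a r\<bar> \<le> (\<Sum>r<k. \<bar>a r\<bar>)"
        using nd(2) by (intro member_le_sum) auto
      moreover have "- (real r / real k * a k) \<le> \<bar>a k\<bar>"
      proof -
        have "- (real r / real k * a k) \<le> \<bar>real r / real k * a k\<bar>"
          by (rule abs_ge_minus_self)
        also have "\<dots> = (real r / real k) * \<bar>a k\<bar>"
          by (simp add: abs_mult)
        also have "\<dots> \<le> 1 * \<bar>a k\<bar>"
          using k nd(2) by (intro mult_right_mono) auto
        finally show ?thesis by simp
      qed
      ultimately have "a n \<le> real n * (a k / real k) + B"
        unfolding B_def by linarith
      then have "a n / real n \<le> a k / real k + B / real n"
        using npos by (simp add: pos_divide_le_eq distrib_right) (simp add: mult.commute)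
      moreover have "L \<le> a n / real n"
        using npos by (intro le) simp
      ultimately show "norm (a n / real n - L) < e"
        unfolding real_norm_def using Bn k(2) by linarith
    qed
  qed
  then have "(\<lambda>n. a n / real n) \<longlonglongrightarrow> L"
    by (intro LIMSEQ_I)
  with le that show thesis by blast
qed

subsection \<open>Sums over words\<close>

definition words :: "'a set \<Rightarrow> nat \<Rightarrow> 'a list set" where
  "words A n = {ws. length ws = n \<and> set ws \<subseteq> A}"

lemma words_0 [simp]: "words A 0 = {[]}"
  by (auto simp: words_def)

lemma bij_betw_Cons_words: "bij_betw (\<lambda>(w, ws). w # ws) (A \<times> words A n) (words A (Suc n))"
  by (rule bij_betwI[where g = "\<lambda>ws. (hd ws, tl ws)"])
    (auto simp: words_def length_Suc_conv)

lemma bij_betw_append_words: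
  "bij_betw (\<lambda>(u, v). u @ v) (words A m \<times> words A n) (words A (m + n))"
  by (rule bij_betwI[where g = "\<lambda>ws. (take m ws, drop m ws)"])
    (auto simp: words_def dest: in_set_takeD in_set_dropD)

lemma iter_sum_eq_infsum_words:
  assumes "f summable_on words {1..} n"
  shows "iter_sum n f = infsum f (words {1..} n)"
  using assms
proof (induction n arbitrary: f)
  case (Suc n)
  have s: "(\<lambda>(w, ws). f (w # ws)) summable_on ({1..} \<times> words {1..} n)"
    using Suc.prems summable_on_reindex_bij_betw[OF bij_betw_Cons_words[of "{1..}" n], of f]
    by (simp add: case_prod_unfold)
  have "infsum f (words {1..} (Suc n)) = infsum (\<lambda>(w, ws). f (w # ws)) ({1..} \<times> words {1..} n)"
    using infsum_reindex_bij_betw[OF bij_betw_Cons_words[of "{1..}" n], of f]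
    by (simp add: case_prod_unfold)
  also have "\<dots> = (\<Sum>\<^sub>\<infinity>w\<in>{1..}. infsum (\<lambda>ws. f (w # ws)) (words {1..} n))"
    using infsum_Sigma'_banach[OF s] by simp
  also have "\<dots> = (\<Sum>\<^sub>\<infinity>w\<in>{1..}. iter_sum n (\<lambda>ws. f (w # ws)))"
  proof (rule infsum_cong)
    fix w :: nat assume "w \<in> {1..}"
    then have "(\<lambda>ws. f (w # ws)) summable_on words {1..} n"
      using summable_on_SigmaD1[OF s, of w] by simp
    then show "infsum (\<lambda>ws. f (w # ws)) (words {1..} n) = iter_sum n (\<lambda>ws. f (w # ws))"
      using Suc.IH by simp
  qed
  finally show ?case by simp
qed simp

lemma has_sum_Times_nonneg:
  fixes f :: "'a \<Rightarrow> real" and g :: "'b \<Rightarrow> real"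
  assumes f: "(f has_sum a) A" and g: "(g has_sum b) B"
    and nonneg: "\<And>x. x \<in> A \<Longrightarrow> f x \<ge> 0" "\<And>y. y \<in> B \<Longrightarrow> g y \<ge> 0"
  shows "((\<lambda>(x, y). f x * g y) has_sum (a * b)) (A \<times> B)"
proof (rule has_sum_SigmaI)
  show "((\<lambda>y. case (x, y) of (x, y) \<Rightarrow> f x * g y) has_sum f x * b) B" for x
    using has_sum_cmult_right[OF g] by simp
  show fb: "((\<lambda>x. f x * b) has_sum a * b) A"
    using has_sum_cmult_left[OF f] by simp
  show "(\<lambda>(x, y). f x * g y) summable_on A \<times> B"
    by (rule summable_on_SigmaI[where g = "\<lambda>x. f x * b"])
      (use has_sum_cmult_right[OF g] has_sum_imp_summable[OF fb] nonneg in auto)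
qed

lemma has_sum_words_prod_list:
  fixes f :: "'a \<Rightarrow> real"
  assumes f: "(f has_sum a) A" and nonneg: "\<And>x. x \<in> A \<Longrightarrow> f x \<ge> 0"
  shows "((\<lambda>ws. prod_list (map f ws)) has_sum a ^ n) (words A n)"
proof (induction n)
  case 0
  show ?case
    using has_sum_finite[of "{[]}" "\<lambda>ws. prod_list (map f ws)"] by simp
next
  case (Suc n)
  have "((\<lambda>(w, ws). f w * prod_list (map f ws)) has_sum (a * a ^ n)) (A \<times> words A n)"
    using nonneg by (intro has_sum_Times_nonneg[OF f Suc.IH])
      (auto simp: words_def subset_iff intro!: prod_list_nonneg)
  then show ?case
    using has_sum_reindex_bij_betw[OF bij_betw_Cons_words[of A n],
        of "\<lambda>ws. prod_list (map f ws)" "a ^ Suc n"]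
    by (simp add: case_prod_unfold)
qed

subsection \<open>Weights of words\<close>

lemma cf_nonneg: "0 \<le> x \<Longrightarrow> 0 \<le> cf ws x"
  by (induction ws) auto

lemma cf_Cons_pos: "0 \<le> x \<Longrightarrow> 1 \<le> w \<Longrightarrow> 0 < cf (w # ws) x"
  using cf_nonneg[of x ws] by simp

lemma cf_Cons_le: "0 \<le> x \<Longrightarrow> 1 \<le> w \<Longrightarrow> cf (w # ws) x \<le> 1 / real w"
  using cf_nonneg[of x ws] by (simp add: frac_le)

lemma cf_in_unit:
  assumes "x \<in> {0..1}" "set ws \<subseteq> {1..}"
  shows "cf ws x \<in> {0..1}"
proof (cases ws)
  case (Cons w vs)
  then have "1 \<le> w" using assms by auto
  with cf_Cons_le[of x w vs] have "cf (w # vs) x \<le> 1"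
    using assms by (auto elim!: order.trans)
  with assms Cons cf_nonneg[of x ws] show ?thesis by simp
qed (use assms in auto)

definition word_prod :: "real \<Rightarrow> real \<Rightarrow> nat list \<Rightarrow> real \<Rightarrow> real" where
  "word_prod t q ws x =
     (\<Prod>j<length ws. real (ws ! j) powr q * cf (drop j ws) x powr (2 * t))"

definition weight :: "real \<Rightarrow> real \<Rightarrow> nat list \<Rightarrow> real" where
  "weight t q ws = exp (birkhoff_sup t q ws)"

lemma word_prod_Nil [simp]: "word_prod t q [] x = 1"
  by (simp add: word_prod_def)

lemma word_prod_Cons:
  "word_prod t q (w # ws) x = real w powr q * cf (w # ws) x powr (2 * t) * word_prod t q ws x"
  by (simp add: word_prod_def prod.lessThan_Suc_shift del: prod.lessThan_Suc cf.simps)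

lemma word_prod_pos:
  assumes "0 \<le> x" "set ws \<subseteq> {1..}"
  shows "0 < word_prod t q ws x"
  using assms(2)
proof (induction ws)
  case (Cons w ws)
  then show ?case
    using cf_Cons_pos[OF assms(1), of w ws] by (auto simp: word_prod_Cons simp del: cf.simps)
qed simp

lemma cf_append: "cf (u @ v) x = cf u (cf v x)"
  by (induction u) auto

lemma word_prod_append: "word_prod t q (u @ v) x = word_prod t q u (cf v x) * word_prod t q v x"
  by (induction u) (simp_all add: word_prod_Cons cf_append)

lemma word_prod_le:
  assumes "0 \<le> x" "0 \<le> t" "set ws \<subseteq> {1..}"
  shows "word_prod t q ws x \<le> prod_list (map (\<lambda>w. real w powr - (2 * t - q)) ws)"
  using assms(3)
proof (induction ws)
  case (Cons w ws)
  then have w: "1 \<le> w" by simp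
  have "cf (w # ws) x powr (2 * t) \<le> (1 / real w) powr (2 * t)"
    using cf_Cons_le[OF assms(1) w] cf_nonneg[OF assms(1)] assms(2) by (intro powr_mono2) auto
  then have "real w powr q * cf (w # ws) x powr (2 * t) \<le> real w powr q * (1 / real w) powr (2 * t)"
    by (intro mult_left_mono) auto
  also have "\<dots> = real w powr - (2 * t - q)"
    using w by (simp add: powr_divide powr_diff)
  finally show ?case
    unfolding word_prod_Cons list.map prod_list.Cons
    using Cons word_prod_pos[OF assms(1), of ws t q] by (intro mult_mono) auto
qed simp

context
  fixes t q :: real
  assumes t: "0 \<le> t"
begin

lemma bdd_above_ln_word_prod:
  assumes "set ws \<subseteq> {1..}"
  shows "bdd_above ((\<lambda>x. ln (word_prod t q ws x)) ` {0..1})"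
  using word_prod_le[OF _ t assms, of _ q] word_prod_pos[OF _ assms, of _ t q]
  by (intro bdd_aboveI2[where M = "ln (prod_list (map (\<lambda>w. real w powr - (2 * t - q)) ws))"])
    (auto intro!: ln_mono)

lemma word_prod_le_weight:
  assumes "set ws \<subseteq> {1..}" "x \<in> {0..1}"
  shows "word_prod t q ws x \<le> weight t q ws"
proof -
  have "ln (word_prod t q ws x) \<le> birkhoff_sup t q ws"
    unfolding birkhoff_sup_def word_prod_def[symmetric]
    using assms bdd_above_ln_word_prod by (intro cSUP_upper) auto
  then show ?thesis
    unfolding weight_def using word_prod_pos[of x ws t q] assms
    by (metis atLeastAtMost_iff exp_le_cancel_iff exp_ln)
qed

lemma weight_le:
  assumes "set ws \<subseteq> {1..}" "\<And>x. x \<in> {0..1} \<Longrightarrow> word_prod t q ws x \<le> c"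
  shows "weight t q ws \<le> c"
proof -
  have c: "0 < c"
    using word_prod_pos[of 0 ws t q] assms(1) assms(2)[of 0] by simp
  have "birkhoff_sup t q ws \<le> ln c"
    unfolding birkhoff_sup_def word_prod_def[symmetric]
    using assms word_prod_pos[of _ ws t q] c by (intro cSUP_least) (auto intro!: ln_mono)
  then show ?thesis
    unfolding weight_def using c by (metis exp_le_cancel_iff exp_ln)
qed

end

lemma weight_pos: "0 < weight t q ws"
  by (simp add: weight_def)

lemma weight_append_le:
  assumes "0 \<le> t" "set u \<subseteq> {1..}" "set v \<subseteq> {1..}"
  shows "weight t q (u @ v) \<le> weight t q u * weight t q v"
proof (rule weight_le[OF assms(1)])
  fix x :: real assume x: "x \<in> {0..1}"
  show "word_prod t q (u @ v) x \<le> weight t q u * weight t q v"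
    unfolding word_prod_append
    using word_prod_le_weight[OF assms(1,2) cf_in_unit[OF x assms(3)]]
      word_prod_le_weight[OF assms(1,3) x] word_prod_pos[OF _ assms(3), of x t q] x
      weight_pos[of t q u]
    by (intro mult_mono) auto
qed (use assms in auto)

lemma word_prod_log_affine:
  assumes "0 \<le> x" "set ws \<subseteq> {1..}" "u + v = 1"
  shows "word_prod t (u * q + v * s) ws x = word_prod t q ws x powr u * word_prod t s ws x powr v"
  using assms(2)
proof (induction ws)
  case (Cons w ws)
  have ws: "set ws \<subseteq> {1..}" using Cons by simp
  have c: "0 < cf (w # ws) x"
    using cf_Cons_pos[OF assms(1), of w ws] Cons by simp
  have "cf (w # ws) x powr (2 * t) = cf (w # ws) x powr (2 * t * u + 2 * t * v)"
    using assms(3) by (simp only: distrib_left[symmetric] mult_1_right)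
  also have "\<dots> = (cf (w # ws) x powr (2 * t)) powr u * (cf (w # ws) x powr (2 * t)) powr v"
    by (simp only: powr_add powr_powr)
  finally have split: "cf (w # ws) x powr (2 * t) = \<dots>" .
  have "real w powr (u * q + v * s) = (real w powr q) powr u * (real w powr s) powr v"
    by (simp add: powr_add powr_powr mult.commute)
  then show ?case
    unfolding word_prod_Cons Cons.IH[OF ws]
    using word_prod_pos[OF assms(1) ws] c
    by (subst split) (simp add: powr_mult less_imp_le mult_ac del: cf.simps)
qed simp

lemma weight_log_convex:
  assumes "0 \<le> t" "set ws \<subseteq> {1..}" "0 \<le> u" "0 \<le> v" "u + v = 1"
  shows "weight t (u * q + v * s) ws \<le> weight t q ws powr u * weight t s ws powr v"
proof (rule weight_le[OF assms(1,2)])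
  fix x :: real assume x: "x \<in> {0..1}"
  then show "word_prod t (u * q + v * s) ws x \<le> weight t q ws powr u * weight t s ws powr v"
    using word_prod_le_weight[OF assms(1,2) x] word_prod_pos[OF _ assms(2), of x] assms
    by (subst word_prod_log_affine) (auto intro!: mult_mono powr_mono2 simp: less_imp_le)
qed

subsection \<open>The partition functions\<close>

definition zeta_sum :: "real \<Rightarrow> real" where
  "zeta_sum s = (\<Sum>\<^sub>\<infinity>w\<in>{1..}. real w powr - s)"

lemma has_sum_zeta_sum:
  assumes "s > 1"
  shows "((\<lambda>w. real w powr - s) has_sum zeta_sum s) {1..}"
proof -
  have "(\<lambda>w. real w powr - s) summable_on UNIV"
    using assms summable_real_powr_iff[of "- s"] by (intro summable_nonneg_imp_summable_on) auto
  then have "(\<lambda>w. real w powr - s) summable_on {1..}"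
    by (rule summable_on_subset_banach) auto
  then show ?thesis
    by (simp add: zeta_sum_def)
qed

lemma zeta_sum_ge_1:
  assumes "s > 1"
  shows "1 \<le> zeta_sum s"
  using has_sum_mono'[OF has_sum_finite[of "{1}" "\<lambda>w. real w powr - s"] has_sum_zeta_sum[OF assms]]
  by simp

lemma zeta_sum_le:
  assumes "s \<ge> 2"
  shows "zeta_sum s \<le> 1 + 2 powr (2 - s) * zeta_sum 2"
proof -
  let ?f = "\<lambda>w::nat. (if w = 1 then 1 else 0) + 2 powr (2 - s) * real w powr - 2"
  have "((\<lambda>w::nat. if w = 1 then 1 else 0) has_sum (1::real)) {1..}"
    using has_sum_finite_neutralI[of "{1::nat}" "{1..}" "\<lambda>w. if w = 1 then 1 else 0" 1] by auto
  then have "(?f has_sum (1 + 2 powr (2 - s) * zeta_sum 2)) {1..}"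
    by (intro has_sum_add has_sum_cmult_right has_sum_zeta_sum) auto
  moreover have "real w powr - s \<le> ?f w" if "w \<in> {1..}" for w
  proof (cases "w = 1")
    case False
    with that have w: "real w \<ge> 2" by simp
    have "real w powr - s = real w powr (2 - s) * real w powr - 2"
      by (simp flip: powr_add)
    also have "\<dots> \<le> 2 powr (2 - s) * real w powr - 2"
      using assms w by (intro mult_right_mono powr_mono2') auto
    finally show ?thesis using False by simp
  qed simp
  ultimately show ?thesis
    using has_sum_mono[OF has_sum_zeta_sum] assms by fastforce
qed

lemma ln_zeta_sum_tendsto_0: "((\<lambda>s. ln (zeta_sum s)) \<longlongrightarrow> 0) at_top"
proof (rule tendsto_sandwich)
  show "\<forall>\<^sub>F s in at_top. 0 \<le> ln (zeta_sum s)"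
    using eventually_gt_at_top[of 1] by eventually_elim (simp add: zeta_sum_ge_1)
  show "\<forall>\<^sub>F s in at_top. ln (zeta_sum s) \<le> 2 powr (2 - s) * zeta_sum 2"
    using eventually_ge_at_top[of 2]
  proof eventually_elim
    case (elim s)
    then have "ln (zeta_sum s) \<le> zeta_sum s - 1"
      using zeta_sum_ge_1[of s] by (intro ln_le_minus_one) auto
    with zeta_sum_le[OF elim] show ?case by linarith
  qed
  have "((\<lambda>s::real. 2 powr (2 - s)) \<longlongrightarrow> 0) at_top"
    by real_asymp
  then show "((\<lambda>s. 2 powr (2 - s) * zeta_sum 2) \<longlongrightarrow> 0) at_top"
    by (rule tendsto_mult_left_zero)
qed simp

definition partition_sum :: "real \<Rightarrow> real \<Rightarrow> nat \<Rightarrow> real" where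
  "partition_sum t q n = iter_sum n (weight t q)"

context
  fixes t :: real
  assumes t: "0 \<le> t"
begin

lemma summable_weight:
  assumes "2 * t - q > 1"
  shows "weight t q summable_on words {1..} n"
proof (rule summable_on_comparison_test)
  show "(\<lambda>ws. prod_list (map (\<lambda>w. real w powr - (2 * t - q)) ws)) summable_on words {1..} n"
    using has_sum_words_prod_list[OF has_sum_zeta_sum[OF assms], of n]
    by (auto intro: has_sum_imp_summable)
  show "weight t q ws \<le> prod_list (map (\<lambda>w. real w powr - (2 * t - q)) ws)"
    if "ws \<in> words {1..} n" for ws
    using that t by (intro weight_le word_prod_le) (auto simp: words_def)
qed (simp add: weight_pos less_imp_le)

lemma has_sum_partition_sum:
  assumes "2 * t - q > 1"
  shows "(weight t q has_sum partition_sum t q n) (words {1..} n)"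
  unfolding partition_sum_def
  using summable_weight[OF assms] by (simp add: iter_sum_eq_infsum_words)

lemma partition_sum_mult_le:
  assumes "2 * t - q > 1"
  shows "partition_sum t q (m + n) \<le> partition_sum t q m * partition_sum t q n"
proof (rule has_sum_mono)
  let ?W = "words {1..}"
  show "((\<lambda>(u, v). weight t q u * weight t q v) has_sum (partition_sum t q m * partition_sum t q n))
      (?W m \<times> ?W n)"
    using has_sum_partition_sum[OF assms]
    by (intro has_sum_Times_nonneg) (auto simp: weight_pos less_imp_le)
  show "((\<lambda>(u, v). weight t q (u @ v)) has_sum partition_sum t q (m + n)) (?W m \<times> ?W n)"
    using has_sum_partition_sum[OF assms, of "m + n"]
      has_sum_reindex_bij_betw[OF bij_betw_append_words[of "{1..}" m n], of "weight t q"]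
    by (simp add: case_prod_unfold)
qed (use weight_append_le[OF t] in \<open>auto simp: words_def\<close>)

lemma word_prod_ge_digits_12:
  assumes "set ws \<subseteq> {1, 2}"
  shows "prod_list (map (\<lambda>w. real w powr q * (1 / 9) powr t) ws) \<le> word_prod t q ws 0"
  using assms
proof (induction ws)
  case (Cons w ws)
  then have w: "w = 1 \<or> w = 2" and ws: "set ws \<subseteq> {1..}" by auto
  have "1 / 3 \<le> cf (w # ws) 0"
    using w cf_in_unit[OF _ ws, of 0] by (auto simp: field_simps)
  then have "(1 / 3) powr (2 * t) \<le> cf (w # ws) 0 powr (2 * t)"
    using t by (intro powr_mono2) auto
  moreover have "(1 / 3) powr (2 * t) = (1 / 9 :: real) powr t"
    by (subst powr_powr[symmetric]) (simp add: power2_eq_square)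
  ultimately have "(1 / 9) powr t \<le> cf (w # ws) 0 powr (2 * t)"
    by simp
  then show ?case
    unfolding word_prod_Cons list.map prod_list.Cons
    using Cons by (intro mult_mono) (auto intro!: prod_list_nonneg)
qed simp

lemma partition_sum_ge:
  assumes "2 * t - q > 1"
  shows "((1 + 2 powr q) * (1 / 9) powr t) ^ n \<le> partition_sum t q n"
proof (rule has_sum_mono_neutral)
  have "((\<lambda>w::nat. real w powr q * (1 / 9) powr t) has_sum ((1 + 2 powr q) * (1 / 9) powr t)) {1, 2}"
    using has_sum_finite[of "{1, 2::nat}" "\<lambda>w. real w powr q * (1 / 9) powr t"]
    by (simp add: distrib_right)
  then show "((\<lambda>ws. prod_list (map (\<lambda>w::nat. real w powr q * (1 / 9) powr t) ws))
      has_sum ((1 + 2 powr q) * (1 / 9) powr t) ^ n) (words {1, 2} n)"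
    by (rule has_sum_words_prod_list) auto
  show "(weight t q has_sum partition_sum t q n) (words {1..} n)"
    by (rule has_sum_partition_sum[OF assms])
  fix ws :: "nat list" assume "ws \<in> words {1, 2} n \<inter> words {1..} n"
  then show "prod_list (map (\<lambda>w. real w powr q * (1 / 9) powr t) ws) \<le> weight t q ws"
    using word_prod_ge_digits_12[of ws q] word_prod_le_weight[OF t, of ws 0 q]
    by (simp add: words_def)
next
  show "prod_list (map (\<lambda>w. real w powr q * (1 / 9) powr t) ws) \<le> 0"
    if "ws \<in> words {1, 2} n - words {1..} n" for ws :: "nat list"
    using that by (auto simp: words_def)
qed (simp add: weight_pos less_imp_le)

lemma partition_sum_pos:
  assumes "2 * t - q > 1"
  shows "0 < partition_sum t q n"
proof -
  have "0 < (1 + 2 powr q) * (1 / 9 :: real) powr t"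
    by (intro mult_pos_pos) (auto intro: add_pos_pos)
  then show ?thesis
    using partition_sum_ge[OF assms, of n] by (metis less_le_trans zero_less_power)
qed

lemma partition_sum_1_le:
  assumes "2 * t - q > 1"
  shows "partition_sum t q 1 \<le> zeta_sum (2 * t - q)"
proof (rule has_sum_mono[OF has_sum_partition_sum[OF assms]])
  show "((\<lambda>ws. prod_list (map (\<lambda>w. real w powr - (2 * t - q)) ws)) has_sum zeta_sum (2 * t - q))
      (words {1..} 1)"
    using has_sum_words_prod_list[OF has_sum_zeta_sum[OF assms], of 1] by simp
  show "weight t q ws \<le> prod_list (map (\<lambda>w. real w powr - (2 * t - q)) ws)"
    if "ws \<in> words {1..} 1" for ws
    using that t by (intro weight_le word_prod_le) (auto simp: words_def)
qed

text \<open>The gain \<open>(1/4)\<^sup>t\<close> comes from \<open>[a, b + x] * [b + x] = 1 / (a * (b + x) + 1) \<le> 1 / 2\<close>.\<close>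

lemma partition_sum_2_le:
  assumes "q < - 1"
  shows "partition_sum t q 2 \<le> (1 / 4) powr t * zeta_sum (- q) ^ 2"
proof (rule has_sum_mono[OF has_sum_partition_sum])
  show "2 * t - q > 1" using assms t by simp
  show "((\<lambda>ws. (1 / 4) powr t * prod_list (map (\<lambda>w. real w powr q) ws)) has_sum
      ((1 / 4) powr t * zeta_sum (- q) ^ 2)) (words {1..} 2)"
    using has_sum_zeta_sum[of "- q"] assms by (intro has_sum_cmult_right has_sum_words_prod_list) auto
  show "weight t q ws \<le> (1 / 4) powr t * prod_list (map (\<lambda>w. real w powr q) ws)"
    if "ws \<in> words {1..} 2" for ws
  proof (rule weight_le[OF t])
    show "set ws \<subseteq> {1..}" using that by (simp add: words_def)
    fix x :: real assume x: "x \<in> {0..1}"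
    obtain a b where ws: "ws = [a, b]" "1 \<le> a" "1 \<le> b"
      using \<open>ws \<in> words {1..} 2\<close> by (auto simp: words_def numeral_2_eq_2 length_Suc_conv)
    have "1 \<le> real a * (real b + x)"
      using mult_mono[of 1 "real a" 1 "real b + x"] ws x by simp
    then have "cf [a, b] x * cf [b] x \<le> 1 / 2"
      using ws x by (simp add: field_simps)
    then have "(cf [a, b] x * cf [b] x) powr (2 * t) \<le> (1 / 2) powr (2 * t)"
      using t x by (intro powr_mono2 mult_nonneg_nonneg cf_nonneg) auto
    moreover have "(1 / 2) powr (2 * t) = (1 / 4 :: real) powr t"
      by (subst powr_powr[symmetric]) (simp add: power2_eq_square)
    ultimately have "cf [a, b] x powr (2 * t) * cf [b] x powr (2 * t) \<le> (1 / 4) powr t"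
      by (simp only: powr_mult)
    then have "cf [a, b] x powr (2 * t) * cf [b] x powr (2 * t) * (real a powr q * real b powr q)
        \<le> (1 / 4) powr t * (real a powr q * real b powr q)"
      by (intro mult_right_mono) auto
    then show "word_prod t q ws x \<le> (1 / 4) powr t * prod_list (map (\<lambda>w. real w powr q) ws)"
      by (simp add: ws word_prod_Cons mult_ac del: cf.simps)
  qed
qed

lemma partition_sum_log_convex:
  assumes "2 * t - q > 1" "2 * t - s > 1" "0 \<le> u" "0 \<le> v" "u + v = 1"
  shows "ln (partition_sum t (u * q + v * s) n)
     \<le> u * ln (partition_sum t q n) + v * ln (partition_sum t s n)"
proof -
  let ?Z = "\<lambda>q. partition_sum t q n" and ?m = "u * q + v * s"
  let ?C = "?Z q powr u * ?Z s powr v"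
  have m: "2 * t - ?m > 1"
    using assms convex_bound_lt[of q "2 * t - 1" s u v] by simp
  note pos = partition_sum_pos[OF assms(1), of n] partition_sum_pos[OF assms(2), of n]
    partition_sum_pos[OF m, of n]
  have "?Z ?m \<le> ?C * (u * (?Z q / ?Z q) + v * (?Z s / ?Z s))"
  proof (rule has_sum_mono[OF has_sum_partition_sum[OF m]])
    show "((\<lambda>ws. ?C * (u * (weight t q ws / ?Z q) + v * (weight t s ws / ?Z s))) has_sum
        ?C * (u * (?Z q / ?Z q) + v * (?Z s / ?Z s))) (words {1..} n)"
      unfolding divide_inverse
      by (intro has_sum_cmult_right has_sum_add has_sum_cmult_left has_sum_partition_sum assms)
    fix ws :: "nat list" assume "ws \<in> words {1..} n"
    then have "weight t ?m ws \<le> weight t q ws powr u * weight t s ws powr v"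
      using assms t by (intro weight_log_convex) (auto simp: words_def)
    also have "\<dots> = ?C * ((weight t q ws / ?Z q) powr u * (weight t s ws / ?Z s) powr v)"
      using pos weight_pos by (simp add: powr_divide less_imp_le)
    also have "\<dots> \<le> ?C * (u * (weight t q ws / ?Z q) + v * (weight t s ws / ?Z s))"
      using pos weight_pos assms by (intro mult_left_mono Youngs_inequality_0) auto
    finally show "weight t ?m ws \<le> \<dots>" .
  qed
  also have "\<dots> = ?C"
    using pos assms by simp
  finally have "ln (?Z ?m) \<le> ln ?C"
    using pos by (intro ln_mono) auto
  then show ?thesis
    using pos by (simp add: ln_mult ln_powr)
qed

subsection \<open>The pressure\<close>

context
  fixes q :: real
  assumes q: "2 * t - q > 1"
begin

lemma ln_partition_sum_ge:
  "(ln (1 + 2 powr q) - t * ln 9) * real n \<le> ln (partition_sum t q n)"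
proof -
  have p: "0 < 1 + 2 powr q" by (auto intro: add_pos_pos)
  then have "ln (((1 + 2 powr q) * (1 / 9) powr t) ^ n) \<le> ln (partition_sum t q n)"
    using partition_sum_ge[OF q, of n] by (intro ln_mono) auto
  moreover have "ln ((1 + 2 powr q) * (1 / 9) powr t) = ln (1 + 2 powr q) - t * ln 9"
    using p by (subst ln_mult) (auto simp: ln_powr ln_div)
  ultimately show ?thesis
    using p by (simp add: ln_realpow mult.commute)
qed

lemma pressure_limit:
  shows pressure_LIMSEQ: "(\<lambda>n. ln (partition_sum t q n) / real n) \<longlonglongrightarrow> P t q"
    and pressure_le: "k > 0 \<Longrightarrow> P t q \<le> ln (partition_sum t q k) / real k"
proof -
  have sub: "ln (partition_sum t q (m + n)) \<le> ln (partition_sum t q m) + ln (partition_sum t q n)"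
    for m n
  proof -
    have "ln (partition_sum t q (m + n)) \<le> ln (partition_sum t q m * partition_sum t q n)"
      using partition_sum_mult_le[OF q] partition_sum_pos[OF q] by (intro ln_mono) auto
    then show ?thesis
      using partition_sum_pos[OF q, of m] partition_sum_pos[OF q, of n] by (simp add: ln_mult)
  qed
  obtain L where L: "(\<lambda>n. ln (partition_sum t q n) / real n) \<longlonglongrightarrow> L"
    "\<And>k. k > 0 \<Longrightarrow> L \<le> ln (partition_sum t q k) / real k"
    using subadditive_LIMSEQ_bound[OF sub ln_partition_sum_ge] by metis
  have "P t q = lim (\<lambda>n. ln (partition_sum t q n) / real n)"
    by (simp add: P_def partition_sum_def weight_def[abs_def])
  with L(1) have "P t q = L"
    by (simp add: limI)
  with L show "(\<lambda>n. ln (partition_sum t q n) / real n) \<longlonglongrightarrow> P t q"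
    and "k > 0 \<Longrightarrow> P t q \<le> ln (partition_sum t q k) / real k"
    by auto
qed

lemma pressure_ge: "ln (1 + 2 powr q) - t * ln 9 \<le> P t q"
proof (rule LIMSEQ_le_const[OF pressure_LIMSEQ], intro exI allI impI)
  fix n :: nat assume "1 \<le> n"
  then show "ln (1 + 2 powr q) - t * ln 9 \<le> ln (partition_sum t q n) / real n"
    using ln_partition_sum_ge[of n] by (simp add: pos_le_divide_eq)
qed

lemma pressure_le_ln_zeta_sum: "P t q \<le> ln (zeta_sum (2 * t - q))"
proof -
  have "P t q \<le> ln (partition_sum t q 1)"
    using pressure_le[of 1] by simp
  also have "\<dots> \<le> ln (zeta_sum (2 * t - q))"
    using partition_sum_1_le[OF q] partition_sum_pos[OF q, of 1] by (intro ln_mono) auto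
  finally show ?thesis .
qed

end

lemma pressure_le_linear_in_t:
  assumes "s > 1"
  shows "P t (- s) \<le> ln (zeta_sum s) - t * ln 2"
proof -
  have q: "2 * t - (- s) > 1" using assms t by simp
  have "ln (partition_sum t (- s) 2) \<le> ln ((1 / 4) powr t * zeta_sum s ^ 2)"
    using partition_sum_2_le[of "- s"] partition_sum_pos[OF q, of 2] assms by (intro ln_mono) auto
  also have "\<dots> = 2 * ln (zeta_sum s) - t * ln (2 ^ 2)"
    using zeta_sum_ge_1[OF assms] by (simp add: ln_mult ln_powr ln_div ln_realpow)
  also have "\<dots> = 2 * (ln (zeta_sum s) - t * ln 2)"
    by (subst ln_realpow) (auto simp: algebra_simps)
  finally show ?thesis
    using pressure_le[OF q, of 2] by simp
qed

lemma convex_on_pressure: "convex_on {..<2 * t - 1} (P t)"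
proof (rule convex_onI)
  fix u x y :: real
  assume u: "0 < u" "u < 1" and xy: "x \<in> {..<2 * t - 1}" "y \<in> {..<2 * t - 1}"
  have x: "2 * t - x > 1" and y: "2 * t - y > 1" using xy by auto
  have m: "2 * t - ((1 - u) * x + u * y) > 1"
    using convex_bound_lt[of x "2 * t - 1" y "1 - u" u] x y u by simp
  have "P t ((1 - u) * x + u * y) \<le> (1 - u) * P t x + u * P t y"
  proof (rule LIMSEQ_le[OF pressure_LIMSEQ[OF m]])
    show "(\<lambda>n. (1 - u) * (ln (partition_sum t x n) / real n) + u * (ln (partition_sum t y n) / real n))
        \<longlonglongrightarrow> (1 - u) * P t x + u * P t y"
      by (intro tendsto_intros pressure_LIMSEQ x y)
    show "\<exists>N. \<forall>n\<ge>N. ln (partition_sum t ((1 - u) * x + u * y) n) / real n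
        \<le> (1 - u) * (ln (partition_sum t x n) / real n) + u * (ln (partition_sum t y n) / real n)"
      using divide_right_mono[OF partition_sum_log_convex[OF x y, of "1 - u" u]] u
      by (auto simp: add_divide_distrib)
  qed
  then show "P t ((1 - u) *\<^sub>R x + u *\<^sub>R y) \<le> (1 - u) * P t x + u * P t y"
    by simp
qed simp

lemma solves_imp_pressure_ge:
  assumes "solves \<xi> (t, q)" "2 * t - q > 1" "2 * t - s > 1"
  shows "\<xi> * s \<le> P t s"
proof -
  have "P t q = q * \<xi>" and "(P t has_real_derivative \<xi>) (at q)"
    using assms(1) by (auto simp: solves_def)
  moreover from this(2) have "\<xi> * (s - q) \<le> P t s - P t q"
    using assms(2,3)
    by (intro convex_on_imp_above_tangent[OF convex_on_pressure])
      (auto simp: interior_open intro: has_field_derivative_at_within)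
  ultimately show ?thesis by (simp add: algebra_simps)
qed

end

subsection \<open>The limits\<close>

context
  fixes t q \<xi> :: real
  assumes D0: "(t, q) \<in> D0" and solves: "solves \<xi> (t, q)" and xi: "\<xi> > 0"
begin

lemma solution_domain: "0 \<le> t" "t \<le> 1" "2 * t - q > 1"
  using D0 by (auto simp: D0_def D_def)

lemma solution_tangent: "2 * t - s > 1 \<Longrightarrow> \<xi> * s \<le> P t s"
  using solves_imp_pressure_ge[OF solution_domain(1) solves solution_domain(3)] .

lemma solution_pressure: "P t q = q * \<xi>"
  using solves by (simp add: solves_def)

lemma t_bounded_below:
  assumes "- M \<le> q" "0 \<le> M"
  shows "min (1 / 2) (ln (1 + 2 powr - M) / ln 9) \<le> t"
proof (cases "q \<le> 0")
  case True
  have "ln (1 + 2 powr - M) \<le> ln (1 + 2 powr q)"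
    using assms by (intro ln_mono) (auto intro: add_pos_pos)
  also have "\<dots> \<le> t * ln 9 + q * \<xi>"
    using pressure_ge[OF solution_domain(1,3)] solution_pressure by simp
  also have "\<dots> \<le> t * ln 9"
    using True xi by (simp add: mult_nonpos_nonneg)
  finally show ?thesis
    by (simp add: pos_divide_le_eq min_le_iff_disj)
next
  case False
  then show ?thesis using solution_domain by auto
qed

lemma xi_bounded_above_if_q_ge:
  assumes "0 < \<epsilon>" "\<epsilon> \<le> q"
  shows "\<xi> * (\<epsilon> / 2) \<le> ln (zeta_sum (1 + \<epsilon> / 2))"
proof -
  have s: "2 * t - \<epsilon> / 2 > 1 + \<epsilon> / 2"
    using solution_domain assms by simp
  have "\<xi> * (\<epsilon> / 2) \<le> P t (\<epsilon> / 2)"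
    using s assms by (intro solution_tangent) simp
  also have "\<dots> \<le> ln (zeta_sum (2 * t - \<epsilon> / 2))"
    using s assms by (intro pressure_le_ln_zeta_sum solution_domain) simp
  also have "\<dots> \<le> ln (zeta_sum (1 + \<epsilon> / 2))"
  proof (rule ln_mono)
    show "zeta_sum (2 * t - \<epsilon> / 2) \<le> zeta_sum (1 + \<epsilon> / 2)"
      using s assms by (intro has_sum_mono[OF has_sum_zeta_sum has_sum_zeta_sum] powr_mono) auto
    show "0 < zeta_sum (2 * t - \<epsilon> / 2)"
      using zeta_sum_ge_1[of "2 * t - \<epsilon> / 2"] s assms by simp
  qed
  finally show ?thesis .
qed

lemma xi_bounded_above_if_q_le:
  assumes "0 < \<epsilon>" "q \<le> - \<epsilon>"
  shows "\<xi> * \<epsilon> \<le> ln 9"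
proof -
  have "0 \<le> ln (1 + 2 powr q)" by simp
  also have "\<dots> \<le> t * ln 9 + q * \<xi>"
    using pressure_ge[OF solution_domain(1,3)] solution_pressure by simp
  also have "t * ln 9 \<le> 1 * ln 9"
    using solution_domain by (intro mult_right_mono) auto
  also have "q * \<xi> \<le> - \<epsilon> * \<xi>"
    using assms xi by (intro mult_right_mono) auto
  finally show ?thesis by (simp add: mult.commute)
qed

end

theorem proposition5p1:
  fixes t q :: "real \<Rightarrow> real"
  assumes "\<And>\<xi>. \<xi> > 0 \<Longrightarrow> (t \<xi>, q \<xi>) \<in> D0 \<and> solves \<xi> (t \<xi>, q \<xi>)"
    and "\<And>\<xi> p. \<xi> > 0 \<Longrightarrow> p \<in> D0 \<Longrightarrow> solves \<xi> p \<Longrightarrow> p = (t \<xi>, q \<xi>)"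
  shows "filterlim q at_bot (at_right 0) \<and> (q \<longlongrightarrow> 0) at_top"
proof
  have sol: "(t \<xi>, q \<xi>) \<in> D0" "solves \<xi> (t \<xi>, q \<xi>)" "\<xi> > 0" if "\<xi> > 0" for \<xi>
    using assms(1)[OF that] that by auto
  show "filterlim q at_bot (at_right 0)"
    unfolding filterlim_at_bot
  proof
    fix Z :: real
    define M where "M = max 0 (- Z)"
    define \<tau> where "\<tau> = min (1 / 2) (ln (1 + 2 powr - M) / ln 9)"
    have tau: "\<tau> > 0"
      unfolding \<tau>_def by (auto intro!: divide_pos_pos ln_gt_zero)
    then have "\<forall>\<^sub>F s in at_top. ln (zeta_sum s) < \<tau> * ln 2"
      using order_tendstoD(2)[OF ln_zeta_sum_tendsto_0] by simp
    then obtain s where s: "s > 1" "ln (zeta_sum s) < \<tau> * ln 2"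
      using eventually_happens[OF eventually_conj[OF _ eventually_gt_at_top[of 1]]] by force
    define \<delta> where "\<delta> = (\<tau> * ln 2 - ln (zeta_sum s)) / s"
    have "\<delta> > 0" using s by (simp add: \<delta>_def)
    moreover have "q \<xi> \<le> Z" if "0 < \<xi>" "\<xi> < \<delta>" for \<xi>
    proof (rule ccontr)
      note sol = sol[OF that(1)]
      assume "\<not> q \<xi> \<le> Z"
      then have "\<tau> \<le> t \<xi>"
        using t_bounded_below[OF sol, of M] that by (auto simp: \<tau>_def M_def)
      then have "\<tau> * ln 2 \<le> t \<xi> * ln 2" by simp
      moreover have "- (\<xi> * s) \<le> P (t \<xi>) (- s)"
        using solution_tangent[OF sol, of "- s"] solution_domain[OF sol] that s by simp
      moreover have "P (t \<xi>) (- s) \<le> ln (zeta_sum s) - t \<xi> * ln 2"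
        using solution_domain[OF sol] that s by (intro pressure_le_linear_in_t) auto
      moreover have "\<xi> * s < \<tau> * ln 2 - ln (zeta_sum s)"
        using that s by (simp add: \<delta>_def pos_less_divide_eq)
      ultimately show False by linarith
    qed
    ultimately show "\<forall>\<^sub>F \<xi> in at_right 0. q \<xi> \<le> Z"
      by (auto simp: eventually_at_right_field)
  qed
  show "(q \<longlongrightarrow> 0) at_top"
  proof (rule tendstoI)
    fix \<epsilon> :: real assume "\<epsilon> > 0"
    define K where "K = max (ln (zeta_sum (1 + \<epsilon> / 2)) / (\<epsilon> / 2)) (ln 9 / \<epsilon>)"
    have "\<bar>q \<xi>\<bar> < \<epsilon>" if "\<xi> > K" "\<xi> > 0" for \<xi>
    proof (rule ccontr)
      note sol = sol[OF that(2)]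
      assume "\<not> \<bar>q \<xi>\<bar> < \<epsilon>"
      then consider "\<epsilon> \<le> q \<xi>" | "q \<xi> \<le> - \<epsilon>" by linarith
      then show False
      proof cases
        case 1
        then show False
          using xi_bounded_above_if_q_ge[OF sol, of \<epsilon>] that \<open>\<epsilon> > 0\<close>
          by (simp add: K_def pos_divide_less_eq mult.commute)
      next
        case 2
        then show False
          using xi_bounded_above_if_q_le[OF sol, of \<epsilon>] that \<open>\<epsilon> > 0\<close>
          by (simp add: K_def pos_divide_less_eq mult.commute)
      qed
    qed
    then show "\<forall>\<^sub>F \<xi> in at_top. dist (q \<xi>) 0 < \<epsilon>"
      by (intro eventually_mono[OF eventually_gt_at_top[of "max K 0"]]) simp
  qed
qed

end
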